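(* Let $d\in\mathbb N$, $T>0$, $m\in(1,\infty)$ and $a\in(0,2)$, and let $u_{BB}$ be the Barenblatt solution of the fractional porous medium equation (see context). Let $\mu\in[1,m]$ and let $\sigma>0$ be non-integer. If $$u_{BB}^{[\mu]}\in L^{\frac m\mu}\big(0,T;\dot W^{\sigma,\frac m\mu}(\mathbb R^d)\big),$$ then $\sigma<\frac{a\mu}{m}$.
   Context: Notation: $w^{[\mu]}:=|w|^{\mu-1}w$. Barenblatt solution. For every $m\in(1,\infty)$ and $a\in(0,2)$ there is (known, Vázquez 2014) a bounded, Hölder continuous, non-negative, not identically vanishing profile $f:[0,\infty)\to\mathbb R$, with $x\mapsto f(|x|)$ integrable on $\mathbb R^d$, such that $$u_{BB}(t,x):=t^{-\alpha}f(|x|t^{-\beta}),\qquad \alpha:=\frac{d}{d(m-1)+a},\quad\beta:=\frac\alpha d,$$ is a self-similar solution of $\partial_tu+(-\Delta)^{a/2}(u^{[m]})=0$ on $(0,\infty)\times\mathbb R^d$. Homogeneous Sobolev–Slobodeckii space. For $\sigma=k+r$ with $k\in\mathbb N_0$, $r\in(0,1)$, and $p\in[1,\infty)$, $\dot W^{\sigma,p}(\mathbb R^d)$ is the space of locally integrable $g$ with $$\|g\|_{\dot W^{\sigma,p}(\mathbb R^d)}:=\Big(\int_{\mathbb R^d\times\mathbb R^d}\frac{|D^kg(x)-D^kg(y)|^p}{|x-y|^{rp+d}}\,dx\,dy\Big)^{1/p}<\infty$$ (modulo functions of zero seminorm). *)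

theory Defs
  imports "HOL-Analysis.Analysis"
begin

definition signed_power :: "real \<Rightarrow> real \<Rightarrow> real" where
  "signed_power \<mu> w = \<bar>w\<bar> powr (\<mu> - 1) * w"

definition locally_integrable :: "('a::euclidean_space \<Rightarrow> real) \<Rightarrow> bool" where
  "locally_integrable g \<longleftrightarrow> (\<forall>K. compact K \<longrightarrow> set_integrable lborel K g)"


section \<open>Test functions and weak derivatives\<close>

primrec dir_derivs :: "'a::euclidean_space list \<Rightarrow> ('a \<Rightarrow> real) \<Rightarrow> 'a \<Rightarrow> real" where
  "dir_derivs [] \<phi> = \<phi>"
| "dir_derivs (v # vs) \<phi> = (\<lambda>x. frechet_derivative (dir_derivs vs \<phi>) (at x) v)"

text \<open>Since every iterated directional derivative is required to be differentiable (hence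
  continuous), the first condition says that \<open>\<phi>\<close> is infinitely differentiable.\<close>

definition is_test_function :: "'a::euclidean_space set \<Rightarrow> ('a \<Rightarrow> real) \<Rightarrow> bool" where
  "is_test_function U \<phi> \<longleftrightarrow>
     (\<forall>vs x. dir_derivs vs \<phi> differentiable (at x)) \<and>
     compact (closure {x. \<phi> x \<noteq> 0}) \<and> closure {x. \<phi> x \<noteq> 0} \<subseteq> U"

definition is_weak_deriv ::
    "'a::euclidean_space list \<Rightarrow> ('a \<Rightarrow> real) \<Rightarrow> ('a \<Rightarrow> real) \<Rightarrow> bool" where
  "is_weak_deriv vs g h \<longleftrightarrow> locally_integrable g \<and> locally_integrable h \<and>
     (\<forall>\<phi>. is_test_function UNIV \<phi> \<longrightarrow>
        (LINT x|lborel. g x * dir_derivs vs \<phi> x) =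
        (- 1) ^ length vs * (LINT x|lborel. h x * \<phi> x))"

text \<open>Weak derivatives are unique only up to null sets; the choice made here is irrelevant
  below, where \<open>weak_deriv\<close> occurs only under Lebesgue integrals.\<close>

definition weak_deriv :: "'a::euclidean_space list \<Rightarrow> ('a \<Rightarrow> real) \<Rightarrow> 'a \<Rightarrow> real" where
  "weak_deriv vs g = (SOME h. is_weak_deriv vs g h)"


section \<open>Homogeneous Sobolev--Slobodeckii spaces of non-integer order\<close>

text \<open>The tensor \<open>D\<^sup>k g\<close> has one entry for each list of \<open>k\<close> basis vectors, and
  its size is measured in the Euclidean norm. Here \<open>k = nat \<lfloor>\<sigma>\<rfloor>\<close> and \<open>r = frac \<sigma>\<close>.\<close>

definition basis_lists :: "nat \<Rightarrow> 'a::euclidean_space list set" where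
  "basis_lists k = {vs. set vs \<subseteq> Basis \<and> length vs = k}"

definition slobodeckii_energy ::
    "real \<Rightarrow> real \<Rightarrow> ('a::euclidean_space \<Rightarrow> real) \<Rightarrow> ennreal" where
  "slobodeckii_energy \<sigma> p g =
     (\<integral>\<^sup>+ (x, y). ennreal
        (L2_set (\<lambda>vs. weak_deriv vs g x - weak_deriv vs g y) (basis_lists (nat \<lfloor>\<sigma>\<rfloor>)) powr p
           / norm (x - y) powr (frac \<sigma> * p + real DIM('a)))
      \<partial>(lborel \<Otimes>\<^sub>M lborel))"

definition in_hom_sobolev :: "real \<Rightarrow> real \<Rightarrow> ('a::euclidean_space \<Rightarrow> real) \<Rightarrow> bool" where
  "in_hom_sobolev \<sigma> p g \<longleftrightarrow> locally_integrable g \<and>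
     (\<forall>vs \<in> basis_lists (nat \<lfloor>\<sigma>\<rfloor>). \<exists>h. is_weak_deriv vs g h) \<and>
     slobodeckii_energy \<sigma> p g < \<infinity>"

definition hom_sobolev_norm :: "real \<Rightarrow> real \<Rightarrow> ('a::euclidean_space \<Rightarrow> real) \<Rightarrow> real" where
  "hom_sobolev_norm \<sigma> p g = enn2real (slobodeckii_energy \<sigma> p g) powr (1 / p)"

text \<open>\<open>L\<^sup>q(0, T; W)\<close> for the homogeneous space \<open>W\<close> of order \<open>\<sigma>\<close> and exponent \<open>p\<close>: strong
  (Bochner) measurability with respect to the seminorm, i.e. almost everywhere approximation by
  simple functions with values in \<open>W\<close>, together with \<open>q\<close>-integrability of the seminorm.
  Functions in \<open>W\<close> are not quotiented explicitly; representatives are used throughout.\<close>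

definition in_Lq_hom_sobolev ::
    "real \<Rightarrow> real \<Rightarrow> real \<Rightarrow> real \<Rightarrow> (real \<Rightarrow> 'a::euclidean_space \<Rightarrow> real) \<Rightarrow> bool" where
  "in_Lq_hom_sobolev T q \<sigma> p g \<longleftrightarrow>
     (let M = restrict_space lborel {0<..<T} in
       (AE t in M. in_hom_sobolev \<sigma> p (g t)) \<and>
       (\<exists>s :: nat \<Rightarrow> real \<Rightarrow> 'a \<Rightarrow> real.
          (\<forall>n. simple_function M (s n) \<and> (\<forall>t. in_hom_sobolev \<sigma> p (s n t))) \<and>
          (AE t in M. (\<lambda>n. hom_sobolev_norm \<sigma> p (\<lambda>x. g t x - s n t x)) \<longlonglongrightarrow> 0)) \<and>
       (\<integral>\<^sup>+ t. ennreal (hom_sobolev_norm \<sigma> p (g t) powr q) \<partial>M) < \<infinity>)"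


section \<open>The fractional porous medium equation and its Barenblatt solutions\<close>

text \<open>\<open>(-\<Delta>)\<^sup>s\<close> on test functions, as the Fourier multiplier \<open>|\<xi>|\<^sup>2\<^sup>s\<close>. The inversion
  integral is real for real-valued \<open>\<phi>\<close>.\<close>

definition frac_laplacian :: "real \<Rightarrow> ('a::euclidean_space \<Rightarrow> real) \<Rightarrow> 'a \<Rightarrow> real" where
  "frac_laplacian s \<phi> x =
     Re (LINT \<xi>|lborel. complex_of_real (norm \<xi> powr (2 * s)) * cis (\<xi> \<bullet> x) *
          (LINT y|lborel. complex_of_real (\<phi> y) * cis (- (\<xi> \<bullet> y))))
     / (2 * pi) ^ DIM('a)"

text \<open>Distributional solutions of \<open>\<partial>\<^sub>t u + (-\<Delta>)\<^sup>a\<^sup>/\<^sup>2 (u\<^sup>[\<^sup>m\<^sup>]) = 0\<close> on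
  \<open>(0,\<infinity>) \<times> \<real>\<^sup>d\<close>; the time derivative is the directional derivative along \<open>(1, 0)\<close>.
  Integrability is part of the definition because \<open>(-\<Delta>)\<^sup>a\<^sup>/\<^sup>2 \<phi>\<close> has no compact support in
  space.\<close>

definition solves_fpme :: "real \<Rightarrow> real \<Rightarrow> (real \<Rightarrow> 'a::euclidean_space \<Rightarrow> real) \<Rightarrow> bool" where
  "solves_fpme m a u \<longleftrightarrow>
     (\<forall>\<phi> :: real \<times> 'a \<Rightarrow> real. is_test_function ({0<..} \<times> UNIV) \<phi> \<longrightarrow>
        set_integrable lborel ({0<..} \<times> UNIV)
          (\<lambda>(t, x). u t x * dir_derivs [(1, 0)] \<phi> (t, x)) \<and>
        set_integrable lborel ({0<..} \<times> UNIV)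
          (\<lambda>(t, x). signed_power m (u t x) * frac_laplacian (a / 2) (\<lambda>y. \<phi> (t, y)) x) \<and>
        (LINT (t, x):{0<..} \<times> UNIV|lborel.
           - (u t x * dir_derivs [(1, 0)] \<phi> (t, x))
           + signed_power m (u t x) * frac_laplacian (a / 2) (\<lambda>y. \<phi> (t, y)) x) = 0)"

text \<open>The profile is determined only up to normalisation of the mass, so this is a predicate
  covering the Barenblatt solutions of all masses. Only times \<open>t > 0\<close> matter.\<close>

definition barenblatt_solution ::
    "real \<Rightarrow> real \<Rightarrow> (real \<Rightarrow> 'a::euclidean_space \<Rightarrow> real) \<Rightarrow> bool" where
  "barenblatt_solution m a u \<longleftrightarrow>
     (\<exists>f :: real \<Rightarrow> real.
        bounded (f ` {0..}) \<and>
        (\<exists>\<gamma> C. 0 < \<gamma> \<and> \<gamma> \<le> 1 \<and> (\<forall>r\<ge>0. \<forall>s\<ge>0. \<bar>f r - f s\<bar> \<le> C * \<bar>r - s\<bar> powr \<gamma>)) \<and>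
        (\<forall>r\<ge>0. 0 \<le> f r) \<and>
        (\<exists>r\<ge>0. f r \<noteq> 0) \<and>
        integrable lborel (\<lambda>x::'a. f (norm x)) \<and>
        (let d = real DIM('a); \<alpha> = d / (d * (m - 1) + a); \<beta> = \<alpha> / d in
           \<forall>t>0. \<forall>x. u t x = t powr (- \<alpha>) * f (norm x * t powr (- \<beta>)))) \<and>
     solves_fpme m a u"

end

(* By self-similarity, u^[mu](t, .) is a multiple of a dilation of u^[mu](t0, .) for one
   fixed t0, so the p-th power of its seminorm (p = m / mu) equals const * t powr rho with
   rho = - (alpha m + beta (sigma p - d)). If the constant is not zero, integrability near t = 0
   forces rho > -1, which is sigma p < a. The constant vanishes only if all weak derivatives of order
   k = floor sigma of g = u^[mu](t0, .) are constant. In that case, for a test function phi and a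
   direction e, put H j y = integral of g(x) (d_e^j phi)(x + y e) dx. Then H (j + 1) is the derivative of H j,
   every H j vanishes at infinity because g is integrable, and H k is constant. Hence H k = 0, and
   inductively H 0 = 0, so that g = 0. *)

theory Submission
  imports Defs "HOL-Real_Asymp.Real_Asymp"
begin

section \<open>Smooth bump functions\<close>

text \<open>The obstacle is that \<open>weak_deriv\<close> is a choice among functions that agree
  only up to null sets. An explicit formula for a derivative, such as that of a dilation, therefore
  reaches the energy only through uniqueness almost everywhere. Uniqueness is the fundamental lemma
  of the calculus of variations, and that lemma needs a concrete supply of test functions, built
  here from exp(-1/s). The degenerate case arises because the seminorm is homogeneous: it vanishes
  on polynomials of degree at most k. Integrability of the profile is what rules these out. Pairing
  with translated test functions avoids any structure theorem for functions with constant weak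
  derivatives and reduces the matter to calculus in one real variable.\<close>

definition exp_recip :: "nat \<Rightarrow> real \<Rightarrow> real" where
  "exp_recip n s = (if s \<le> 0 then 0 else exp (- 1 / s) / s ^ n)"

lemma exp_recip_tendsto_0: "(exp_recip n \<longlongrightarrow> 0) (at 0)"
proof -
  have "((\<lambda>s. exp (- 1 / s) / s ^ n) \<longlongrightarrow> 0) (at_right (0::real))"
    by real_asymp
  then have "(exp_recip n \<longlongrightarrow> 0) (at_right 0)"
    by (rule Lim_transform_eventually)
      (auto simp: exp_recip_def eventually_at_right_less intro: eventually_mono[OF eventually_at_right_less])
  moreover have "(exp_recip n \<longlongrightarrow> 0) (at_left 0)"
    by (rule Lim_transform_eventually[OF tendsto_const])
      (auto simp: exp_recip_def eventually_at_filter)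
  ultimately show ?thesis
    by (simp add: filterlim_at_split)
qed

text \<open>Differentiating exp(-1/s) produces a factor 1/s^2, and differentiating 1/s^n raises the
  exponent by one. Carrying the factor 1/s^n in \<open>exp_recip\<close> keeps all derivatives in
  the span of one family.\<close>

lemma exp_recip_has_derivative:
  "(exp_recip n has_real_derivative (exp_recip (n + 2) s - real n * exp_recip (n + 1) s)) (at s)"
proof (cases s "0::real" rule: linorder_cases)
  case less
  have "((\<lambda>s. 0) has_real_derivative 0) (at s)" by simp
  then have "(exp_recip n has_real_derivative 0) (at s)"
    by (rule DERIV_cong_ev[THEN iffD1, rotated 3])
      (auto simp: exp_recip_def intro!: eventually_mono[OF eventually_nhds_in_open[of "{..<0}" s]] less)
  then show ?thesis using less by (simp add: exp_recip_def)
next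
  case equal
  \<comment> \<open>The difference quotient at 0 is the next member of the family, which tends to 0
    because the exponential beats every power.\<close>
  have "((\<lambda>h. (exp_recip n (0 + h) - exp_recip n 0) / h) \<longlongrightarrow> 0) (at 0)"
    by (rule Lim_transform_eventually[OF exp_recip_tendsto_0[of "Suc n"]])
      (auto simp: exp_recip_def field_simps eventually_at_filter)
  then show ?thesis using equal by (simp add: DERIV_def exp_recip_def)
next
  case greater
  have *: "s ^ k = s * s ^ (k - Suc 0)" if "k \<noteq> 0" for k
    using that by (cases k) auto
  have "((\<lambda>s. exp (- 1 / s) / s ^ n) has_real_derivative
      (exp_recip (n + 2) s - real n * exp_recip (n + 1) s)) (at s)"
    using greater
    by (cases n) (auto intro!: derivative_eq_intros simp: exp_recip_def field_simps power2_eq_square, use * in blast)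
  then show ?thesis
    by (rule DERIV_cong_ev[THEN iffD1, rotated 3])
      (auto simp: exp_recip_def greater intro!: eventually_mono[OF eventually_nhds_in_open[of "{0<..}" s]])
qed

text \<open>This class is closed under directional derivatives, so all its members are smooth.\<close>

inductive_set bump_algebra :: "('a::euclidean_space \<Rightarrow> real) set" where
  bump_const: "(\<lambda>x. c) \<in> bump_algebra"
| bump_inner: "(\<lambda>x. x \<bullet> v) \<in> bump_algebra"
| bump_add: "f \<in> bump_algebra \<Longrightarrow> g \<in> bump_algebra \<Longrightarrow> (\<lambda>x. f x + g x) \<in> bump_algebra"
| bump_mult: "f \<in> bump_algebra \<Longrightarrow> g \<in> bump_algebra \<Longrightarrow> (\<lambda>x. f x * g x) \<in> bump_algebra"
| bump_exp_recip: "f \<in> bump_algebra \<Longrightarrow> (\<lambda>x. exp_recip n (f x)) \<in> bump_algebra"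

text \<open>Differentiability and closure under directional derivatives are carried through one
  induction, since the product and chain rules express the new derivative through the old
  one.\<close>

lemma bump_algebra_has_derivative:
  assumes "f \<in> bump_algebra"
  shows "\<exists>D. (\<forall>x. (f has_derivative D x) (at x)) \<and> (\<forall>v. (\<lambda>x. D x v) \<in> bump_algebra)"
  using assms
proof induction
  case (bump_const c)
  then show ?case
    by (intro exI[of _ "\<lambda>x v. 0"]) (auto intro: bump_algebra.intros)
next
  case (bump_inner v)
  then show ?case
    by (intro exI[of _ "\<lambda>x w. w \<bullet> v"]) (auto intro!: bump_algebra.intros derivative_eq_intros)
next
  case (bump_add f g)
  then obtain D E where "\<forall>x. (f has_derivative D x) (at x)" "\<forall>v. (\<lambda>x. D x v) \<in> bump_algebra"
    "\<forall>x. (g has_derivative E x) (at x)" "\<forall>v. (\<lambda>x. E x v) \<in> bump_algebra" by blast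
  then show ?case
    by (intro exI[of _ "\<lambda>x v. D x v + E x v"]) (auto intro!: bump_algebra.intros has_derivative_add)
next
  case (bump_mult f g)
  then obtain D E where "\<forall>x. (f has_derivative D x) (at x)" "\<forall>v. (\<lambda>x. D x v) \<in> bump_algebra"
    "\<forall>x. (g has_derivative E x) (at x)" "\<forall>v. (\<lambda>x. E x v) \<in> bump_algebra" by blast
  with bump_mult show ?case
    by (intro exI[of _ "\<lambda>x v. f x * E x v + D x v * g x"])
      (auto intro!: bump_algebra.intros has_derivative_mult)
next
  case (bump_exp_recip f n)
  then obtain D where D: "\<forall>x. (f has_derivative D x) (at x)" "\<forall>v. (\<lambda>x. D x v) \<in> bump_algebra"
    by blast
  \<comment> \<open>The subtraction in the derivative of \<open>exp_recip\<close> is written as a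
    sum with a constant factor, the form that the introduction rules of the class produce.\<close>
  have "((\<lambda>x. exp_recip n (f x)) has_derivative
      (\<lambda>v. (exp_recip (n + 2) (f x) + - real n * exp_recip (n + 1) (f x)) * D x v)) (at x)" for x
    using has_derivative_compose[OF D(1)[rule_format]
        exp_recip_has_derivative[unfolded has_field_derivative_def]]
    by simp
  with D bump_exp_recip.hyps show ?case
    by (intro exI[of _ "\<lambda>x v. (exp_recip (n + 2) (f x) + - real n * exp_recip (n + 1) (f x)) * D x v"])
      (intro conjI allI bump_algebra.intros; simp)
qed

lemma dir_derivs_bump_algebra: "f \<in> bump_algebra \<Longrightarrow> dir_derivs vs f \<in> bump_algebra"
proof (induction vs)
  case (Cons v vs)
  then obtain D where D: "\<And>x. (dir_derivs vs f has_derivative D x) (at x)"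
    "\<And>v. (\<lambda>x. D x v) \<in> bump_algebra"
    using bump_algebra_has_derivative by blast
  show ?case using D(2)[of v] by (simp flip: frechet_derivative_at[OF D(1)])
qed simp

section \<open>Smooth approximation of the indicators of boxes\<close>

lemma bump_algebra_prod:
  "finite I \<Longrightarrow> (\<And>i. i \<in> I \<Longrightarrow> f i \<in> bump_algebra) \<Longrightarrow> (\<lambda>x. \<Prod>i\<in>I. f i x) \<in> bump_algebra"
  by (induction I rule: finite_induct) (auto intro: bump_algebra.intros)

text \<open>As n grows, \<open>exp_recip 0 (n * s)\<close> tends to 1 for s > 0 and stays 0 for s
  \<le> 0. With one factor for each face, the product tends pointwise to the indicator of the open
  box; n controls the steepness.\<close>

definition box_bump :: "nat \<Rightarrow> 'a \<Rightarrow> 'a \<Rightarrow> 'a::euclidean_space \<Rightarrow> real" where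
  "box_bump n a b x = (\<Prod>i\<in>Basis. exp_recip 0 (real n * (x \<bullet> i - a \<bullet> i)) *
     exp_recip 0 (real n * (b \<bullet> i - x \<bullet> i)))"

lemma exp_recip_0_bounds: "0 \<le> exp_recip 0 s" "exp_recip 0 s \<le> 1"
  by (auto simp: exp_recip_def)

lemma box_bump_eq_0: "x \<notin> box a b \<Longrightarrow> box_bump n a b x = 0"
  by (force simp: box_bump_def box_def exp_recip_def mult_le_0_iff not_less)

lemma abs_box_bump_le_1: "\<bar>box_bump n a b x\<bar> \<le> 1"
  unfolding box_bump_def abs_prod
  by (intro prod_le_1) (auto simp: abs_mult exp_recip_0_bounds mult_le_one)

lemma box_bump_tendsto: "(\<lambda>n. box_bump n a b x) \<longlonglongrightarrow> indicator (box a b) x"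
proof (cases "x \<in> box a b")
  case True
  have "(\<lambda>n. exp_recip 0 (real n * s)) \<longlonglongrightarrow> 1" if "s > 0" for s
  proof -
    have "(\<lambda>n. exp (- 1 / (real n * s))) \<longlonglongrightarrow> 1" using that by real_asymp
    then show ?thesis
      by (rule Lim_transform_eventually)
        (use that in \<open>auto simp: exp_recip_def mult_le_0_iff intro!: eventually_mono[OF eventually_gt_at_top[of 0]]\<close>)
  qed
  with True have "(\<lambda>n. box_bump n a b x) \<longlonglongrightarrow> (\<Prod>i\<in>(Basis::'a set). 1 * 1)"
    unfolding box_bump_def by (intro tendsto_prod tendsto_mult) (auto simp: box_def)
  then show ?thesis using True by simp
qed (simp add: box_bump_eq_0)

lemma is_test_function_box_bump: "is_test_function UNIV (box_bump n a b)"
proof -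
  have "box_bump n a b = (\<lambda>x. \<Prod>i\<in>Basis. exp_recip 0 (real n * (x \<bullet> i + - (a \<bullet> i))) *
      exp_recip 0 (real n * (b \<bullet> i + (-1) * (x \<bullet> i))))"
    by (simp add: box_bump_def fun_eq_iff)
  also have "\<dots> \<in> bump_algebra"
    by (intro bump_algebra_prod bump_algebra.intros) auto
  finally have "box_bump n a b \<in> bump_algebra" .
  then have "dir_derivs vs (box_bump n a b) differentiable at x" for vs x
    using bump_algebra_has_derivative[OF dir_derivs_bump_algebra] by (metis differentiableI)
  moreover have "bounded {x. box_bump n a b x \<noteq> 0}"
    by (rule bounded_subset[OF bounded_box[of a b]]) (use box_bump_eq_0 in blast)
  ultimately show ?thesis by (simp add: is_test_function_def)
qed

section \<open>Test functions\<close>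

lemma dir_derivs_append: "dir_derivs (vs @ ws) \<phi> = dir_derivs vs (dir_derivs ws \<phi>)"
  by (induction vs) auto

lemma test_function_has_derivative:
  assumes "is_test_function U \<phi>"
  shows "(dir_derivs vs \<phi> has_derivative (\<lambda>v. dir_derivs (v # vs) \<phi> x)) (at x)"
proof -
  have "dir_derivs vs \<phi> differentiable at x"
    using assms unfolding is_test_function_def by blast
  then show ?thesis by (simp flip: frechet_derivative_works)
qed

text \<open>The complement of the closed support is open, so vanishing there passes from a function
  to its derivatives.\<close>

lemma dir_derivs_eq_0_outside_support:
  "x \<notin> closure {x. \<phi> x \<noteq> 0} \<Longrightarrow> dir_derivs vs \<phi> x = 0"
proof (induction vs arbitrary: x)
  case (Cons v vs)
  have "(dir_derivs vs \<phi> has_derivative (\<lambda>v. 0)) (at x)"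
    by (rule has_derivative_transform_within_open[OF has_derivative_const,
          of "- closure {x. \<phi> x \<noteq> 0}"])
      (use Cons in \<open>simp_all add: open_Compl\<close>)
  from frechet_derivative_at[OF this, symmetric] show ?case by simp
next
  case Nil
  then show ?case using closure_subset[of "{x. \<phi> x \<noteq> 0}"] by auto
qed

lemma is_test_function_dir_derivs:
  assumes "is_test_function U \<phi>"
  shows "is_test_function U (dir_derivs vs \<phi>)"
proof -
  have "closure {x. dir_derivs vs \<phi> x \<noteq> 0} \<subseteq> closure {x. \<phi> x \<noteq> 0}"
    using dir_derivs_eq_0_outside_support[of _ \<phi> vs] by (intro closure_minimal subsetI) auto
  moreover from this have "compact (closure {x. dir_derivs vs \<phi> x \<noteq> 0})"
    using assms compact_Int_closed[OF _ closed_closure, of "closure {x. \<phi> x \<noteq> 0}"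
        "{x. dir_derivs vs \<phi> x \<noteq> 0}"]
    by (simp add: is_test_function_def inf_absorb2)
  moreover have "dir_derivs ws (dir_derivs vs \<phi>) differentiable at x" for ws x
    using assms unfolding is_test_function_def dir_derivs_append[symmetric] by blast
  ultimately show ?thesis
    using assms unfolding is_test_function_def by blast
qed

lemma test_function_continuous: "is_test_function U \<phi> \<Longrightarrow> continuous_on S \<phi>"
  by (rule has_derivative_continuous_on, rule has_derivative_at_withinI,
      rule test_function_has_derivative[of U \<phi> "[]", unfolded dir_derivs.simps(1)])

lemma test_function_borel_measurable: "is_test_function U \<phi> \<Longrightarrow> \<phi> \<in> borel_measurable borel"
  by (intro borel_measurable_continuous_onI test_function_continuous)

lemma test_function_bounded:
  assumes "is_test_function U \<phi>"
  obtains B where "\<And>x. \<bar>\<phi> x\<bar> \<le> B" "B > 0"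
proof -
  let ?K = "closure {x. \<phi> x \<noteq> 0}"
  have "compact (\<phi> ` ?K)"
    using assms by (intro compact_continuous_image test_function_continuous[OF assms])
      (auto simp: is_test_function_def)
  then obtain B where B: "B > 0" "\<And>x. x \<in> ?K \<Longrightarrow> \<bar>\<phi> x\<bar> \<le> B"
    by (auto dest!: compact_imp_bounded simp: bounded_pos)
  have "\<bar>\<phi> x\<bar> \<le> B" for x
    using B closure_subset[of "{x. \<phi> x \<noteq> 0}"] by (cases "\<phi> x = 0") auto
  with B(1) show ?thesis using that by blast
qed

text \<open>Each direction \<open>v\<close> turns into \<open>s *\<^sub>R v\<close>, and linearity
  pulls out one factor s per derivative. Dilations serve the scaling of weak derivatives,
  translations the sliding test functions in the degenerate case.\<close>

lemma dir_derivs_affine: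
  assumes "is_test_function U \<phi>"
  shows "dir_derivs vs (\<lambda>x. \<phi> (b + s *\<^sub>R x)) = (\<lambda>x. s ^ length vs * dir_derivs vs \<phi> (b + s *\<^sub>R x))"
proof (induction vs)
  case (Cons v vs)
  have "((\<lambda>x. s ^ length vs * dir_derivs vs \<phi> (b + s *\<^sub>R x)) has_derivative
      (\<lambda>v. s ^ length vs * dir_derivs ((s *\<^sub>R v) # vs) \<phi> (b + s *\<^sub>R x))) (at x)" for x
    by (rule derivative_eq_intros has_derivative_compose[OF _ test_function_has_derivative[OF assms]] refl)+
      simp
  then have *: "((\<lambda>x. s ^ length vs * dir_derivs vs \<phi> (b + s *\<^sub>R x)) has_derivative
      (\<lambda>v. s ^ length vs * (s * dir_derivs (v # vs) \<phi> (b + s *\<^sub>R x)))) (at x)" for x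
    using linear_cmul[OF has_derivative_linear[OF test_function_has_derivative[OF assms]]]
    by simp
  show ?case using Cons by (simp add: mult_ac flip: frechet_derivative_at[OF *])
qed simp

lemma is_test_function_affine:
  assumes "is_test_function UNIV \<phi>" "s \<noteq> 0"
  shows "is_test_function UNIV (\<lambda>x. \<phi> (b + s *\<^sub>R x))"
proof -
  have "(\<lambda>x. s ^ length vs * dir_derivs vs \<phi> (b + s *\<^sub>R x)) differentiable (at x)" for vs x
    by (rule differentiableI,
        (rule derivative_eq_intros has_derivative_compose[OF _ test_function_has_derivative[OF assms(1)]] refl)+)
  moreover
  let ?g = "\<lambda>y. (1 / s) *\<^sub>R (y - b)"
  have "{x. \<phi> (b + s *\<^sub>R x) \<noteq> 0} \<subseteq> ?g ` closure {x. \<phi> x \<noteq> 0}"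
  proof
    fix x assume "x \<in> {x. \<phi> (b + s *\<^sub>R x) \<noteq> 0}"
    then have "b + s *\<^sub>R x \<in> closure {x. \<phi> x \<noteq> 0}" using closure_subset by fastforce
    moreover have "x = ?g (b + s *\<^sub>R x)" using assms(2) by simp
    ultimately show "x \<in> ?g ` closure {x. \<phi> x \<noteq> 0}" by blast
  qed
  moreover have "compact (?g ` closure {x. \<phi> x \<noteq> 0})"
    using assms by (intro compact_continuous_image continuous_intros) (auto simp: is_test_function_def)
  ultimately show ?thesis
    by (auto simp: is_test_function_def dir_derivs_affine[OF assms(1)]
        intro: bounded_subset[OF compact_imp_bounded])
qed

section \<open>Affine changes of variables\<close>

lemma nn_integral_lborel_affine:
  fixes t :: "'a::euclidean_space"
  assumes [measurable]: "f \<in> borel_measurable borel" and "c \<noteq> 0"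
  shows "(\<integral>\<^sup>+x. f x \<partial>lborel) = ennreal (\<bar>c\<bar> ^ DIM('a)) * (\<integral>\<^sup>+x. f (t + c *\<^sub>R x) \<partial>lborel)"
  by (subst lborel_affine[OF assms(2), of t])
    (simp add: nn_integral_density nn_integral_distr nn_integral_cmult)

lemma lborel_integrable_affine:
  fixes f :: "'a::euclidean_space \<Rightarrow> real"
  assumes f: "integrable lborel f" and c: "c \<noteq> 0"
  shows "integrable lborel (\<lambda>x. f (t + c *\<^sub>R x))"
proof -
  have [measurable]: "f \<in> borel_measurable borel" using f by auto
  have "ennreal (\<bar>c\<bar> ^ DIM('a)) * (\<integral>\<^sup>+x. ennreal (norm (f (t + c *\<^sub>R x))) \<partial>lborel) < \<infinity>"
    using f c nn_integral_lborel_affine[of "\<lambda>x. ennreal (norm (f x))" c t]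
    by (simp add: integrable_iff_bounded)
  then show ?thesis using c by (auto simp: integrable_iff_bounded ennreal_mult_less_top)
qed

lemma lborel_integral_affine:
  fixes f :: "'a::euclidean_space \<Rightarrow> real"
  assumes [measurable]: "f \<in> borel_measurable borel" and c: "c \<noteq> 0"
  shows "(LINT x|lborel. f x) = \<bar>c\<bar> ^ DIM('a) * (LINT x|lborel. f (t + c *\<^sub>R x))"
  by (subst lborel_affine[OF c, of t]) (simp add: integral_density integral_distr)

section \<open>The fundamental lemma of the calculus of variations\<close>

text \<open>Local integrability gives measurability on compact sets only; h is the pointwise limit
  of its truncations to balls of integer radius.\<close>

lemma locally_integrable_measurable:
  assumes "locally_integrable h"
  shows "h \<in> borel_measurable borel"
proof (rule borel_measurable_LIMSEQ_real)
  fix x :: 'a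
  obtain N :: nat where N: "norm x \<le> real N" using real_arch_simple by blast
  have "indicator (cball 0 (real n)) x * h x = h x" if "n \<ge> N" for n
    using that N by (simp add: indicator_def)
  then show "(\<lambda>n. indicator (cball 0 (real n)) x * h x) \<longlonglongrightarrow> h x"
    by (intro tendsto_eventually) (auto simp: eventually_sequentially intro!: exI[of _ N])
next
  fix n :: nat
  have "set_integrable lborel (cball 0 (real n)) h"
    using assms by (simp add: locally_integrable_def)
  then show "(\<lambda>x. indicator (cball 0 (real n)) x * h x) \<in> borel_measurable borel"
    by (auto simp: set_integrable_def dest: borel_measurable_integrable)
qed

lemma integrable_imp_locally_integrable:
  assumes "integrable lborel h"
  shows "locally_integrable h"
  unfolding locally_integrable_def set_integrable_def real_scaleR_def
  using assms by (auto intro!: integrable_mult_indicator[where 'b=real, unfolded real_scaleR_def]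
      dest: borel_compact)

lemma locally_integrable_mult_test_function:
  assumes "locally_integrable h" "is_test_function UNIV \<phi>"
  shows "integrable lborel (\<lambda>x. h x * \<phi> x)"
proof -
  let ?K = "closure {x. \<phi> x \<noteq> 0}"
  obtain B where B: "\<And>x. \<bar>\<phi> x\<bar> \<le> B" "B > 0" using test_function_bounded[OF assms(2)] by blast
  have "set_integrable lborel ?K h"
    using assms by (auto simp: locally_integrable_def is_test_function_def)
  then have "integrable lborel (\<lambda>x. B * (indicator ?K x * h x))"
    by (simp add: set_integrable_def)
  moreover have "(\<lambda>x. h x * \<phi> x) \<in> borel_measurable lborel"
    using locally_integrable_measurable[OF assms(1)] test_function_borel_measurable[OF assms(2)]
    by measurable
  moreover have bound: "norm (h x * \<phi> x) \<le> norm (B * (indicator ?K x * h x))" for x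
  proof (cases "\<phi> x = 0")
    case False
    then have "x \<in> ?K" using closure_subset by fastforce
    then show ?thesis using B mult_right_mono[OF B(1)[of x], of "\<bar>h x\<bar>"]
      by (simp add: abs_mult mult.commute)
  qed simp
  ultimately show ?thesis by (blast intro: Bochner_Integration.integrable_bound)
qed

lemma locally_integrable_diff:
  "locally_integrable g \<Longrightarrow> locally_integrable h \<Longrightarrow> locally_integrable (\<lambda>x. g x - h x)"
  unfolding locally_integrable_def by blast

text \<open>Dominated convergence along the box bumps, which are bounded by 1 and vanish outside the
  open box. The majorant lives on the closed box because local integrability speaks of compact
  sets.\<close>

lemma integral_box_eq_0:
  assumes h: "locally_integrable h"
    and 0: "\<And>\<phi>. is_test_function UNIV \<phi> \<Longrightarrow> (LINT x|lborel. h x * \<phi> x) = 0"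
  shows "(LINT x|lborel. h x * indicator (box a b) x) = 0"
proof -
  have [measurable]: "h \<in> borel_measurable borel" by (rule locally_integrable_measurable[OF h])
  have "(\<lambda>n. LINT x|lborel. h x * box_bump n a b x) \<longlonglongrightarrow> (LINT x|lborel. h x * indicator (box a b) x)"
  proof (rule integral_dominated_convergence)
    have "set_integrable lborel (cbox a b) h" using h by (auto simp: locally_integrable_def)
    then show "integrable lborel (\<lambda>x. \<bar>indicator (cbox a b) x * h x\<bar>)"
      by (intro integrable_abs) (simp add: set_integrable_def)
    show "AE x in lborel. (\<lambda>n. h x * box_bump n a b x) \<longlonglongrightarrow> h x * indicator (box a b) x"
      by (intro AE_I2 tendsto_mult tendsto_const box_bump_tendsto)
    show "AE x in lborel. norm (h x * box_bump n a b x) \<le> \<bar>indicator (cbox a b) x * h x\<bar>" for n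
    proof (rule AE_I2)
      fix x :: 'a
      show "norm (h x * box_bump n a b x) \<le> \<bar>indicator (cbox a b) x * h x\<bar>"
        using abs_box_bump_le_1[of n a b x] box_bump_eq_0[of x a b n] box_subset_cbox[of a b]
        by (cases "x \<in> box a b") (auto simp: abs_mult mult_left_le)
    qed
    show "(\<lambda>x. h x * box_bump n a b x) \<in> borel_measurable lborel" for n
      using test_function_borel_measurable[OF is_test_function_box_bump] by measurable
  qed measurable
  then show ?thesis by (simp add: 0 is_test_function_box_bump LIMSEQ_const_iff)
qed

text \<open>The measures with the positive and the negative part of h as densities agree on all open
  boxes. Boxes are stable under intersection and generate the Borel sets, so the measures coincide,
  and hence so do the densities almost everywhere. A real number whose positive and negative parts
  are equal is 0.\<close>

lemma AE_eq_0_if_integral_test_functions_eq_0: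
  assumes h: "locally_integrable h"
    and 0: "\<And>\<phi>. is_test_function UNIV \<phi> \<Longrightarrow> (LINT x|lborel. h x * \<phi> x) = 0"
  shows "AE x in lborel. h x = 0"
proof -
  have [measurable]: "h \<in> borel_measurable borel" by (rule locally_integrable_measurable[OF h])
  have int: "integrable lborel (\<lambda>x. h x * indicator (box a b) x)" for a b
  proof (rule Bochner_Integration.integrable_bound)
    show "integrable lborel (\<lambda>x. indicator (cbox a b) x * h x)"
      using h by (auto simp: locally_integrable_def set_integrable_def)
  qed (use box_subset_cbox in \<open>auto simp: indicator_def\<close>)
  \<comment> \<open>Since \<open>ennreal\<close> sends negative numbers to 0, s = 1 gives the
    positive part and s = -1 the negative part.\<close>
  have fin: "(\<integral>\<^sup>+x. ennreal (s * (h x * indicator (box a b) x)) \<partial>lborel) < \<infinity>"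
    if "\<bar>s\<bar> = 1" for s :: real and a b
  proof -
    have "(\<integral>\<^sup>+x. ennreal (s * (h x * indicator (box a b) x)) \<partial>lborel)
        \<le> (\<integral>\<^sup>+x. ennreal (norm (h x * indicator (box a b) x)) \<partial>lborel)"
      using that by (intro nn_integral_mono ennreal_leI) (auto simp: abs_if split: if_splits)
    also have "\<dots> < \<infinity>" using int by (simp add: integrable_iff_bounded)
    finally show ?thesis .
  qed
  have dens: "emeasure (density lborel (\<lambda>x. ennreal (s * h x))) (box a b) =
      (\<integral>\<^sup>+x. ennreal (s * (h x * indicator (box a b) x)) \<partial>lborel)" for s a b
    by (subst emeasure_density) (auto intro!: nn_integral_cong simp: indicator_def)
  have eq: "emeasure (density lborel (\<lambda>x. ennreal (1 * h x))) (box a b) =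
      emeasure (density lborel (\<lambda>x. ennreal ((-1) * h x))) (box a b)" for a b
  proof -
    let ?I = "\<lambda>s. \<integral>\<^sup>+x. ennreal (s * (h x * indicator (box a b) x)) \<partial>lborel"
    \<comment> \<open>The vanishing integral is the difference of these two numbers. Finiteness is
      needed to return to \<open>ennreal\<close>, because \<open>enn2real\<close> maps infinity to
      0.\<close>
    have "enn2real (?I 1) = enn2real (?I (-1))"
      using real_lebesgue_integral_def[OF int[of a b]] integral_box_eq_0[OF h 0, of a b] by simp
    then have "ennreal (enn2real (?I 1)) = ennreal (enn2real (?I (-1)))" by (rule arg_cong)
    moreover have "?I 1 < top" "?I (-1) < top"
      using fin[of 1 a b] fin[of "-1" a b] by simp_all
    ultimately show ?thesis
      unfolding dens by (simp only: ennreal_enn2real)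
  qed
  have "density lborel (\<lambda>x. ennreal (1 * h x)) = density lborel (\<lambda>x. ennreal ((-1) * h x))"
  proof (rule measure_eqI_generator_eq[where \<Omega> = UNIV])
    show "Int_stable (range (\<lambda>(a, b). box a b :: 'a set))"
    proof (rule Int_stableI)
      fix X Y :: "'a set" assume "X \<in> range (\<lambda>(a, b). box a b)" "Y \<in> range (\<lambda>(a, b). box a b)"
      then obtain a b c d where XY: "X = box a b" "Y = box c d" by auto
      obtain p q where "X \<inter> Y = box p q" unfolding XY box_Int_box by blast
      then show "X \<inter> Y \<in> range (\<lambda>(a, b). box a b)" by auto
    qed
    show "range (\<lambda>n::nat. box (- (real n *\<^sub>R One)) (real n *\<^sub>R One :: 'a)) \<subseteq> range (\<lambda>(a, b). box a b)"
      by auto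
    show "emeasure (density lborel (\<lambda>x. ennreal (1 * h x))) (box (- (real n *\<^sub>R One)) (real n *\<^sub>R One)) \<noteq> \<infinity>"
      for n :: nat
      using fin[of 1 "- (real n *\<^sub>R One)" "real n *\<^sub>R One"] unfolding dens by auto
  qed (use eq UN_box_eq_UNIV in \<open>auto simp: borel_eq_box\<close>)
  then have "AE x in lborel. ennreal (1 * h x) = ennreal ((-1) * h x)"
    by (rule sigma_finite_measure.density_unique[OF sigma_finite_lborel, rotated 2]) auto
  moreover have zero: "y = 0" if "ennreal (1 * y) = ennreal ((-1) * y)" for y
    using that by (cases "y \<ge> 0") (auto simp: ennreal_neg ennreal_eq_0_iff dest: sym)
  ultimately show ?thesis by (elim AE_mp) (intro AE_I2 impI zero)
qed

text \<open>Links the chosen function \<open>weak_deriv\<close> to any weak derivative that is known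
  explicitly.\<close>

lemma weak_deriv_unique:
  assumes "is_weak_deriv vs g h" "is_weak_deriv vs g h'"
  shows "AE x in lborel. h x = h' x"
proof -
  have loc: "locally_integrable h" "locally_integrable h'"
    using assms by (auto simp: is_weak_deriv_def)
  have "AE x in lborel. h x - h' x = 0"
  proof (rule AE_eq_0_if_integral_test_functions_eq_0)
    fix \<phi> :: "'a \<Rightarrow> real" assume \<phi>: "is_test_function UNIV \<phi>"
    then have "(- 1) ^ length vs * (LINT x|lborel. h x * \<phi> x) =
        (- 1) ^ length vs * (LINT x|lborel. h' x * \<phi> x)"
      using assms unfolding is_weak_deriv_def by metis
    then show "(LINT x|lborel. (h x - h' x) * \<phi> x) = 0"
      using loc by (simp add: left_diff_distrib locally_integrable_mult_test_function \<phi>)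
  qed (use loc in \<open>rule locally_integrable_diff\<close>)
  then show ?thesis by simp
qed

lemma weak_deriv_is_weak_deriv: "is_weak_deriv vs g h \<Longrightarrow> is_weak_deriv vs g (weak_deriv vs g)"
  unfolding weak_deriv_def by (rule someI[of "is_weak_deriv vs g"])

section \<open>Dilations of weak derivatives\<close>

lemma locally_integrable_scale:
  assumes "locally_integrable (g :: 'a::euclidean_space \<Rightarrow> real)" "s \<noteq> 0"
  shows "locally_integrable (\<lambda>x. c * g (s *\<^sub>R x))"
  unfolding locally_integrable_def
proof (intro allI impI)
  fix K :: "'a set" assume "compact K"
  then have "set_integrable lborel ((*\<^sub>R) s ` K) g"
    using assms(1) compact_scaling unfolding locally_integrable_def by blast
  then have "integrable lborel (\<lambda>x. c * (indicator ((*\<^sub>R) s ` K) (0 + s *\<^sub>R x) * g (0 + s *\<^sub>R x)))"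
    using assms(2) unfolding set_integrable_def
    by (intro integrable_mult_right lborel_integrable_affine[of "\<lambda>x. indicator ((*\<^sub>R) s ` K) x * g x"]) auto
  moreover have "indicator ((*\<^sub>R) s ` K) (s *\<^sub>R x) = (indicator K x :: real)" for x
    using assms(2) by (auto simp: indicator_def)
  ultimately show "set_integrable lborel K (\<lambda>x. c * g (s *\<^sub>R x))"
    by (simp add: set_integrable_def mult_ac)
qed

text \<open>The dilation is moved onto the test function by the substitution x to x / s. The
  Jacobian factor \<bar>s\<bar>^d appears on both sides and cancels, leaving one factor s per
  derivative.\<close>

lemma is_weak_deriv_scale:
  fixes g :: "'a::euclidean_space \<Rightarrow> real"
  assumes "is_weak_deriv vs g h" "s \<noteq> 0"
  shows "is_weak_deriv vs (\<lambda>x. c * g (s *\<^sub>R x)) (\<lambda>x. c * s ^ length vs * h (s *\<^sub>R x))"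
proof -
  have loc: "locally_integrable g" "locally_integrable h"
    using assms by (auto simp: is_weak_deriv_def)
  note meas [measurable] = loc[THEN locally_integrable_measurable]
  have "(LINT x|lborel. c * g (s *\<^sub>R x) * dir_derivs vs \<phi> x) =
      (- 1) ^ length vs * (LINT x|lborel. c * s ^ length vs * h (s *\<^sub>R x) * \<phi> x)"
    if \<phi>: "is_test_function UNIV \<phi>" for \<phi>
  proof -
    define \<psi> where "\<psi> = (\<lambda>x. \<phi> (0 + (1 / s) *\<^sub>R x))"
    have \<psi>: "is_test_function UNIV \<psi>"
      unfolding \<psi>_def using assms(2) by (intro is_test_function_affine[OF \<phi>]) auto
    note [measurable] = \<psi>[THEN test_function_borel_measurable]
      \<psi>[THEN is_test_function_dir_derivs, THEN test_function_borel_measurable]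
    have \<phi>_eq: "\<phi> = (\<lambda>x. \<psi> (0 + s *\<^sub>R x))" using assms(2) by (simp add: \<psi>_def)
    have "(LINT x|lborel. c * g (s *\<^sub>R x) * dir_derivs vs \<phi> x) =
        c * s ^ length vs * (LINT x|lborel. g (0 + s *\<^sub>R x) * dir_derivs vs \<psi> (0 + s *\<^sub>R x))"
      unfolding \<phi>_eq dir_derivs_affine[OF \<psi>] integral_mult_right_zero[symmetric]
      by (simp add: mult_ac)
    also have "\<dots> * \<bar>s\<bar> ^ DIM('a) = c * s ^ length vs * (LINT x|lborel. g x * dir_derivs vs \<psi> x)"
      using lborel_integral_affine[of "\<lambda>x. g x * dir_derivs vs \<psi> x" s 0] assms(2) by simp
    also have "\<dots> = c * s ^ length vs * ((- 1) ^ length vs * (LINT x|lborel. h x * \<psi> x))"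
      using assms(1) \<psi> by (simp add: is_weak_deriv_def)
    also have "\<dots> = (- 1) ^ length vs * (c * s ^ length vs * (LINT x|lborel. h (0 + s *\<^sub>R x) * \<psi> (0 + s *\<^sub>R x))) * \<bar>s\<bar> ^ DIM('a)"
      using lborel_integral_affine[of "\<lambda>x. h x * \<psi> x" s 0] assms(2) by simp
    also have "c * s ^ length vs * (LINT x|lborel. h (0 + s *\<^sub>R x) * \<psi> (0 + s *\<^sub>R x)) =
        (LINT x|lborel. c * s ^ length vs * h (s *\<^sub>R x) * \<phi> x)"
      unfolding \<phi>_eq integral_mult_right_zero[symmetric] by (simp add: mult_ac)
    finally show ?thesis using assms(2) by simp
  qed
  with loc assms(2) show ?thesis by (simp add: is_weak_deriv_def locally_integrable_scale)
qed

section \<open>Integrable functions with constant higher derivatives\<close>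

lemma integrable_mult_test_function:
  assumes "integrable lborel F" "is_test_function UNIV \<phi>"
  shows "integrable lborel (\<lambda>x. F x * \<phi> (x + y *\<^sub>R e))"
  using locally_integrable_mult_test_function[OF integrable_imp_locally_integrable[OF assms(1)]
      is_test_function_affine[OF assms(2), of 1 "y *\<^sub>R e"]]
  by (simp add: add.commute)

text \<open>For fixed x the point x + y e eventually leaves the support of \<phi>, so the integrand
  tends to 0 pointwise. Integrability of F over the whole space supplies the majorant.\<close>

lemma integral_translate_tendsto_0:
  fixes F :: "'a::euclidean_space \<Rightarrow> real"
  assumes F: "integrable lborel F" and \<phi>: "is_test_function UNIV \<phi>" and "e \<noteq> 0"
  shows "((\<lambda>y. LINT x|lborel. F x * \<phi> (x + y *\<^sub>R e)) \<longlongrightarrow> 0) at_top"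
proof -
  obtain B where B: "\<And>x. \<bar>\<phi> x\<bar> \<le> B" "B > 0" using test_function_bounded[OF \<phi>] by blast
  note [measurable] = test_function_borel_measurable[OF \<phi>] borel_measurable_integrable[OF F]
  have "bounded (closure {x. \<phi> x \<noteq> 0})"
    using \<phi> by (simp add: is_test_function_def compact_imp_bounded)
  then obtain R where R: "\<And>x. norm x > R \<Longrightarrow> \<phi> x = 0"
    using closure_subset[of "{x. \<phi> x \<noteq> 0}"] unfolding bounded_iff by (metis (mono_tags) leD mem_Collect_eq subsetD)
  have "((\<lambda>y. LINT x|lborel. F x * \<phi> (x + y *\<^sub>R e)) \<longlongrightarrow> (LINT x|(lborel::'a measure). 0)) at_top"
  proof (rule integral_dominated_convergence_at_top)
    show "integrable lborel (\<lambda>x. \<bar>F x\<bar> * B)" using F by simp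
    show "\<forall>\<^sub>F y in at_top. AE x in lborel. norm (F x * \<phi> (x + y *\<^sub>R e)) \<le> \<bar>F x\<bar> * B"
      using B by (intro always_eventually allI AE_I2) (simp add: abs_mult mult_left_mono)
    show "AE x in lborel. ((\<lambda>y. F x * \<phi> (x + y *\<^sub>R e)) \<longlongrightarrow> 0) at_top"
    proof (rule AE_I2, rule tendsto_eventually)
      fix x :: 'a
      \<comment> \<open>R may be negative; the absolute value makes the threshold nonnegative, so
        that y > 0 and the norm of y e is y times that of e.\<close>
      have "F x * \<phi> (x + y *\<^sub>R e) = 0" if "y > (\<bar>R\<bar> + norm x) / norm e" for y
      proof -
        have "y > 0" using that by (meson abs_ge_zero add_nonneg_nonneg divide_nonneg_nonneg le_less_trans norm_ge_zero)
        moreover have "\<bar>R\<bar> + norm x < y * norm e" using that assms(3) by (simp add: field_simps)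
        ultimately have "R < norm (x + y *\<^sub>R e)" using norm_diff_ineq[of "y *\<^sub>R e" x]
          by (simp add: add.commute)
        then show ?thesis by (simp add: R)
      qed
      then show "\<forall>\<^sub>F y in at_top. F x * \<phi> (x + y *\<^sub>R e) = 0"
        by (rule eventually_mono[OF eventually_gt_at_top])
    qed
  qed measurable
  then show ?thesis by simp
qed

text \<open>By the mean value inequality the difference quotients of \<phi> along e are bounded by a
  bound B of its derivative, so \<open>\<bar>F x\<bar> * B\<close> justifies differentiation under
  the integral. The limit is tested along sequences to fit dominated convergence.\<close>

lemma integral_translate_has_derivative:
  fixes F :: "'a::euclidean_space \<Rightarrow> real"
  assumes F: "integrable lborel F" and \<phi>: "is_test_function UNIV \<phi>"
  shows "((\<lambda>y. LINT x|lborel. F x * \<phi> (x + y *\<^sub>R e)) has_real_derivative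
    (LINT x|lborel. F x * dir_derivs [e] \<phi> (x + y *\<^sub>R e))) (at y)"
proof -
  let ?\<phi>' = "dir_derivs [e] \<phi>"
  have \<phi>': "is_test_function UNIV ?\<phi>'" by (rule is_test_function_dir_derivs[OF \<phi>])
  obtain B where B: "\<And>x. \<bar>?\<phi>' x\<bar> \<le> B" "B > 0" using test_function_bounded[OF \<phi>'] by blast
  note [measurable] = test_function_borel_measurable[OF \<phi>] test_function_borel_measurable[OF \<phi>']
    borel_measurable_integrable[OF F]
  have der: "((\<lambda>s. \<phi> (x + s *\<^sub>R e)) has_real_derivative ?\<phi>' (x + s *\<^sub>R e)) (at s)" for x s
  proof -
    have "((\<lambda>s. \<phi> (x + s *\<^sub>R e)) has_derivative (\<lambda>h. dir_derivs [h *\<^sub>R e] \<phi> (x + s *\<^sub>R e))) (at s)"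
      by (rule derivative_eq_intros refl
          has_derivative_compose[OF _ test_function_has_derivative[OF \<phi>, of "[]", unfolded dir_derivs.simps(1)]])+
        simp
    moreover have "dir_derivs [h *\<^sub>R e] \<phi> z = h * ?\<phi>' z" for h z
      using linear_cmul[OF has_derivative_linear[OF test_function_has_derivative[OF \<phi>, of "[]"]]] by simp
    ultimately show ?thesis by (simp add: has_field_derivative_def mult_commute_abs)
  qed
  have "(\<lambda>n. LINT x|lborel. F x * ((\<phi> (x + (y + X n) *\<^sub>R e) - \<phi> (x + y *\<^sub>R e)) / X n))
      \<longlonglongrightarrow> (LINT x|lborel. F x * ?\<phi>' (x + y *\<^sub>R e))"
    if X: "\<And>n. X n \<noteq> 0" "X \<longlonglongrightarrow> 0" for X
  proof (rule integral_dominated_convergence)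
    show "integrable lborel (\<lambda>x. \<bar>F x\<bar> * B)" using F by simp
    have "(\<lambda>n. (\<phi> (x + (y + X n) *\<^sub>R e) - \<phi> (x + y *\<^sub>R e)) / X n) \<longlonglongrightarrow> ?\<phi>' (x + y *\<^sub>R e)" for x
      using der[of x y, unfolded DERIV_def tendsto_at_iff_sequentially comp_def] X by auto
    then show "AE x in lborel. (\<lambda>n. F x * ((\<phi> (x + (y + X n) *\<^sub>R e) - \<phi> (x + y *\<^sub>R e)) / X n))
        \<longlonglongrightarrow> F x * ?\<phi>' (x + y *\<^sub>R e)"
      by (intro AE_I2 tendsto_mult tendsto_const)
    have "\<bar>\<phi> (x + (y + X n) *\<^sub>R e) - \<phi> (x + y *\<^sub>R e)\<bar> \<le> B * \<bar>X n\<bar>" for x n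
      using field_differentiable_bound[of UNIV "\<lambda>s. \<phi> (x + s *\<^sub>R e)" "\<lambda>s. ?\<phi>' (x + s *\<^sub>R e)" B "y + X n" y] der B
      by simp
    then show "AE x in lborel. norm (F x * ((\<phi> (x + (y + X n) *\<^sub>R e) - \<phi> (x + y *\<^sub>R e)) / X n)) \<le> \<bar>F x\<bar> * B" for n
      using X(1) by (intro AE_I2) (auto simp: abs_mult divide_le_eq mult.assoc intro!: mult_left_mono)
  qed measurable
  then show ?thesis
    unfolding DERIV_def tendsto_at_iff_sequentially comp_def
    using integrable_mult_test_function[OF F \<phi>]
    by (simp add: right_diff_distrib diff_divide_distrib)
qed

text \<open>A pure derivative in one direction suffices, since F is examined only along translations
  in that direction. For k = 0 this says that an integrable function that is constant almost
  everywhere vanishes.\<close>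

lemma AE_eq_0_if_weak_deriv_const:
  fixes F :: "'a::euclidean_space \<Rightarrow> real"
  assumes F: "integrable lborel F" and e: "e \<noteq> 0"
    and h: "is_weak_deriv (replicate k e) F h" and c: "AE x in lborel. h x = c"
  shows "AE x in lborel. F x = 0"
proof (rule AE_eq_0_if_integral_test_functions_eq_0[OF integrable_imp_locally_integrable[OF F]])
  fix \<phi> :: "'a \<Rightarrow> real" assume \<phi>: "is_test_function UNIV \<phi>"
  define H where "H = (\<lambda>j y. LINT x|lborel. F x * dir_derivs (replicate j e) \<phi> (x + y *\<^sub>R e))"
  have lim: "(H j \<longlongrightarrow> 0) at_top" for j
    unfolding H_def by (intro integral_translate_tendsto_0 F is_test_function_dir_derivs \<phi> e)
  have der: "(H j has_real_derivative H (Suc j) y) (at y)" for j y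
    using integral_translate_has_derivative[OF F is_test_function_dir_derivs[OF \<phi>]]
    by (simp add: H_def)
  have const_0: "H j = (\<lambda>_. 0)" if "\<And>y. H j y = H j 0" for j
  proof -
    have "H j = (\<lambda>_. H j 0)" using that by blast
    with lim[of j] have "((\<lambda>_. H j 0) \<longlongrightarrow> 0) (at_top :: real filter)" by metis
    then have "H j 0 = 0" by (simp add: tendsto_const_iff)
    with that show ?thesis by auto
  qed
  \<comment> \<open>The weak derivative takes over all k derivatives of the translated test
    function; as it equals c, translation invariance of the integral removes y.\<close>
  have "H k y = (- 1) ^ k * (c * (LINT x|lborel. \<phi> x))" for y
  proof -
    have \<phi>y: "is_test_function UNIV (\<lambda>x. \<phi> (y *\<^sub>R e + 1 *\<^sub>R x))"
      by (intro is_test_function_affine[OF \<phi>]) simp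
    note [measurable] = test_function_borel_measurable[OF \<phi>] test_function_borel_measurable[OF \<phi>y]
    have [measurable]: "h \<in> borel_measurable borel"
      using h by (auto simp: is_weak_deriv_def intro: locally_integrable_measurable)
    have "H k y = (LINT x|lborel. F x * dir_derivs (replicate k e) (\<lambda>x. \<phi> (y *\<^sub>R e + 1 *\<^sub>R x)) x)"
      unfolding H_def dir_derivs_affine[OF \<phi>] by (simp add: add.commute)
    also have "\<dots> = (- 1) ^ k * (LINT x|lborel. h x * \<phi> (y *\<^sub>R e + 1 *\<^sub>R x))"
      using h \<phi>y unfolding is_weak_deriv_def by simp
    also have "(LINT x|lborel. h x * \<phi> (y *\<^sub>R e + 1 *\<^sub>R x)) = (LINT x|lborel. c * \<phi> (y *\<^sub>R e + 1 *\<^sub>R x))"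
      using c by (intro integral_cong_AE) auto
    also have "\<dots> = c * (LINT x|lborel. \<phi> x)"
      using lborel_integral_affine[of \<phi> 1 "y *\<^sub>R e"] by simp
    finally show ?thesis .
  qed
  then have "H k = (\<lambda>_. 0)" using const_0[of k] by simp
  have "H 0 = (\<lambda>_. 0)"
    using le0[of k]
  proof (induction rule: inc_induct)
    case base
    show ?case by fact
  next
    case (step j)
    have "H j y = H j 0" for y
      using DERIV_isconst_all[of "H j" y 0] der[of j] step.IH by simp
    then show ?case by (rule const_0)
  qed
  then show "(LINT x|lborel. F x * \<phi> x) = 0"
    by (auto simp: H_def dest: fun_cong[of _ _ 0])
qed

section \<open>The Slobodeckii energy\<close>

lemma finite_basis_lists: "finite (basis_lists k :: 'a::euclidean_space list set)"
  unfolding basis_lists_def by (rule finite_lists_length_eq) simp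

text \<open>Carries identities of weak derivatives, valid almost everywhere on the space, into the
  double integral that defines the energy.\<close>

lemma AE_lborel_pairI:
  assumes "AE x in (lborel :: 'a::euclidean_space measure). P x"
  shows "AE z in lborel \<Otimes>\<^sub>M lborel. P (fst z) \<and> P (snd (z :: 'a \<times> 'a))"
proof -
  from assms obtain N :: "'a set" where N: "{x. \<not> P x} \<subseteq> N" "N \<in> null_sets lborel"
    by (auto elim!: AE_E simp: null_sets_def)
  have "N \<times> UNIV \<in> null_sets (lborel \<Otimes>\<^sub>M lborel)" "UNIV \<times> N \<in> null_sets (lborel \<Otimes>\<^sub>M lborel)"
    using lborel.times_in_null_sets1[OF N(2), of UNIV] lborel.times_in_null_sets2[OF sets.top[of lborel] N(2)] by simp_all
  then have "N \<times> UNIV \<union> UNIV \<times> N \<in> null_sets (lborel \<Otimes>\<^sub>M lborel)" by blast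
  then show ?thesis by (rule AE_I') (use N(1) in auto)
qed

lemma slobodeckii_integrand_measurable:
  fixes H :: "'a::euclidean_space list \<Rightarrow> 'a \<Rightarrow> real"
  assumes H: "\<And>vs. vs \<in> basis_lists k \<Longrightarrow> H vs \<in> borel_measurable borel"
  shows "(\<lambda>(x, y). ennreal (L2_set (\<lambda>vs. H vs x - H vs y) (basis_lists k) powr p
     / norm (x - y) powr b)) \<in> borel_measurable (lborel \<Otimes>\<^sub>M lborel)"
proof -
  have [measurable]: "(\<lambda>z. \<Sum>vs\<in>basis_lists k. (H vs (fst z) - H vs (snd z))\<^sup>2) \<in> borel_measurable (lborel \<Otimes>\<^sub>M lborel)"
  proof (rule borel_measurable_sum)
    fix vs :: "'a list" assume "vs \<in> basis_lists k"
    from H[OF this] have [measurable]: "H vs \<in> borel_measurable borel" .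
    show "(\<lambda>z. (H vs (fst z) - H vs (snd z))\<^sup>2) \<in> borel_measurable (lborel \<Otimes>\<^sub>M lborel)"
      by measurable
  qed
  show ?thesis unfolding L2_set_def case_prod_beta by measurable
qed

text \<open>If the energy vanishes, Fubini gives a single point x such that, at almost every y, all
  derivatives of order k take the values they have at x. They are thus constant almost everywhere,
  which forces the integrable g to vanish.\<close>

lemma slobodeckii_energy_pos:
  fixes g :: "'a::euclidean_space \<Rightarrow> real"
  assumes g: "integrable lborel g" "\<not> (AE x in lborel. g x = 0)"
    and W: "in_hom_sobolev \<sigma> p g"
  shows "slobodeckii_energy \<sigma> p g > 0"
proof (rule ccontr)
  let ?k = "nat \<lfloor>\<sigma>\<rfloor>"
  let ?B = "basis_lists ?k :: 'a list set"
  let ?L = "\<lambda>x y. L2_set (\<lambda>vs. weak_deriv vs g x - weak_deriv vs g y) ?B"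
  let ?E = "\<lambda>(x, y). ennreal (?L x y powr p / norm (x - y) powr (frac \<sigma> * p + real DIM('a)))"
  have wd: "is_weak_deriv vs g (weak_deriv vs g)" if "vs \<in> ?B" for vs
    using W that weak_deriv_is_weak_deriv unfolding in_hom_sobolev_def by blast
  then have meas: "weak_deriv vs g \<in> borel_measurable borel" if "vs \<in> ?B" for vs
    using that by (auto simp: is_weak_deriv_def intro: locally_integrable_measurable)
  have E: "?E \<in> borel_measurable (lborel \<Otimes>\<^sub>M lborel)"
    by (rule slobodeckii_integrand_measurable[OF meas])
  assume "\<not> slobodeckii_energy \<sigma> p g > 0"
  then have "AE z in lborel \<Otimes>\<^sub>M lborel. ?E z = 0"
    unfolding slobodeckii_energy_def using E by (simp add: nn_integral_0_iff_AE)
  then have "AE x in lborel. AE y in lborel. ?E (x, y) = 0"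
    by (rule lborel_pair.AE_pair)
  then obtain x where "AE y in lborel. ?E (x, y) = 0"
    using eventually_happens[of _ "ae_filter (lborel :: 'a measure)"]
    by (force simp: trivial_limit_def eventually_ae_filter)
  \<comment> \<open>On the diagonal the integrand carries no information, but \<open>?L\<close>
    vanishes there anyway. Off it the denominator is positive and \<open>powr\<close> is zero only
    at base 0.\<close>
  moreover have "?L x y = 0" if "?E (x, y) = 0" for y
    using that by (cases "x = y") (auto simp: divide_le_0_iff ennreal_eq_0_iff L2_set_0')
  moreover have "\<forall>vs\<in>?B. weak_deriv vs g y = weak_deriv vs g x" if "?L x y = 0" for y
    using that by (simp add: L2_set_eq_0_iff finite_basis_lists)
  ultimately have const: "AE y in lborel. \<forall>vs\<in>?B. weak_deriv vs g y = weak_deriv vs g x"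
    by (elim AE_mp) (intro AE_I2, blast)
  obtain e :: 'a where "e \<in> Basis" using nonempty_Basis by blast
  then have e: "replicate ?k e \<in> ?B" "e \<noteq> 0" by (auto simp: basis_lists_def)
  from const e(1) have "AE y in lborel. weak_deriv (replicate ?k e) g y = weak_deriv (replicate ?k e) g x"
    by (auto)
  with g wd[OF e(1)] e(2) show False using AE_eq_0_if_weak_deriv_const by blast
qed

text \<open>Three powers of s combine: k p from the derivatives, frac \<sigma> p + d from the
  kernel, and -2d from the change of variables on pairs. They add up to \<sigma> p - d because k +
  frac \<sigma> = \<sigma>.\<close>

lemma slobodeckii_energy_scale:
  fixes g :: "'a::euclidean_space \<Rightarrow> real"
  assumes "\<sigma> > 0" "p > 0" "s > 0"
    and wd_ex: "\<forall>vs \<in> basis_lists (nat \<lfloor>\<sigma>\<rfloor>). \<exists>h. is_weak_deriv vs g h"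
  shows "slobodeckii_energy \<sigma> p (\<lambda>x. c * g (s *\<^sub>R x)) =
    ennreal (\<bar>c\<bar> powr p * s powr (\<sigma> * p - real DIM('a))) * slobodeckii_energy \<sigma> p g"
proof -
  define k where "k = nat \<lfloor>\<sigma>\<rfloor>"
  define B where "B = (basis_lists k :: 'a list set)"
  define b where "b = frac \<sigma> * p + real DIM('a)"
  \<comment> \<open>The family of derivatives is a parameter, so that one integrand serves both g
    and its dilation.\<close>
  define Q where "Q = (\<lambda>H :: 'a list \<Rightarrow> 'a \<Rightarrow> real. \<lambda>(x, y).
    ennreal (L2_set (\<lambda>vs. H vs x - H vs y) B powr p / norm (x - y) powr b))"
  define H where "H = (\<lambda>vs. weak_deriv vs g)"
  define H' where "H' = (\<lambda>vs. weak_deriv vs (\<lambda>x. c * g (s *\<^sub>R x)))"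
  have energy: "slobodeckii_energy \<sigma> p g = (\<integral>\<^sup>+z. Q H z \<partial>(lborel \<Otimes>\<^sub>M lborel))"
    "slobodeckii_energy \<sigma> p (\<lambda>x. c * g (s *\<^sub>R x)) = (\<integral>\<^sup>+z. Q H' z \<partial>(lborel \<Otimes>\<^sub>M lborel))"
    by (simp_all add: slobodeckii_energy_def Q_def H_def H'_def B_def k_def b_def)
  have wd: "is_weak_deriv vs g (H vs)" if "vs \<in> B" for vs
    using that wd_ex weak_deriv_is_weak_deriv unfolding H_def B_def k_def by blast
  have "AE x in lborel. H' vs x = c * s ^ k * H vs (s *\<^sub>R x)" if "vs \<in> B" for vs
  proof (rule weak_deriv_unique)
    show *: "is_weak_deriv vs (\<lambda>x. c * g (s *\<^sub>R x)) (\<lambda>x. c * s ^ k * H vs (s *\<^sub>R x))"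
      using is_weak_deriv_scale[OF wd[OF that], of s c] assms(3) that by (simp add: B_def basis_lists_def)
    then show "is_weak_deriv vs (\<lambda>x. c * g (s *\<^sub>R x)) (H' vs)"
      unfolding H'_def by (rule weak_deriv_is_weak_deriv)
  qed
  then have "AE x in lborel. \<forall>vs\<in>B. H' vs x = c * s ^ k * H vs (s *\<^sub>R x)"
    using finite_basis_lists unfolding B_def by (intro AE_finite_allI) auto
  then have AE: "AE z in lborel \<Otimes>\<^sub>M lborel. (\<forall>vs\<in>B. H' vs (fst z) = c * s ^ k * H vs (s *\<^sub>R fst z)) \<and>
      (\<forall>vs\<in>B. H' vs (snd z) = c * s ^ k * H vs (s *\<^sub>R snd z))"
    by (rule AE_lborel_pairI)
  let ?C = "\<bar>c * s ^ k\<bar> powr p * s powr b"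
  have Q_scale: "Q H' (x, y) = ennreal ?C * Q H (s *\<^sub>R x, s *\<^sub>R y)"
    if eq: "\<forall>vs\<in>B. H' vs x = c * s ^ k * H vs (s *\<^sub>R x)" "\<forall>vs\<in>B. H' vs y = c * s ^ k * H vs (s *\<^sub>R y)" for x y
  proof -
    have "L2_set (\<lambda>vs. H' vs x - H' vs y) B =
        L2_set (\<lambda>vs. \<bar>c * s ^ k\<bar> * (H vs (s *\<^sub>R x) - H vs (s *\<^sub>R y))) B"
      using eq unfolding L2_set_def
      by (intro arg_cong[of _ _ sqrt] sum.cong refl) (simp add: power_mult_distrib flip: right_diff_distrib)
    also have "\<dots> = \<bar>c * s ^ k\<bar> * L2_set (\<lambda>vs. H vs (s *\<^sub>R x) - H vs (s *\<^sub>R y)) B"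
      by (rule L2_set_right_distrib[symmetric]) simp
    finally have L: "L2_set (\<lambda>vs. H' vs x - H' vs y) B =
        \<bar>c * s ^ k\<bar> * L2_set (\<lambda>vs. H vs (s *\<^sub>R x) - H vs (s *\<^sub>R y)) B" .
    have "norm (s *\<^sub>R x - s *\<^sub>R y) = s * norm (x - y)"
      using assms(3) by (simp flip: scaleR_diff_right)
    then show ?thesis
      using assms(3) unfolding Q_def case_prod_conv L
      by (simp add: powr_mult L2_set_nonneg field_simps flip: ennreal_mult')
  qed
  have Q_meas: "Q H \<in> borel_measurable borel"
    using slobodeckii_integrand_measurable[of k H p b] wd
    unfolding Q_def B_def by (auto simp: lborel_prod is_weak_deriv_def intro: locally_integrable_measurable)
  have "slobodeckii_energy \<sigma> p (\<lambda>x. c * g (s *\<^sub>R x)) =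
      (\<integral>\<^sup>+z. ennreal ?C * Q H (0 + s *\<^sub>R z) \<partial>(lborel \<Otimes>\<^sub>M lborel))"
    unfolding energy by (rule nn_integral_cong_AE, rule AE_mp[OF AE]) (auto simp: Q_scale)
  also have "\<dots> = ennreal ?C * (\<integral>\<^sup>+z. Q H (0 + s *\<^sub>R z) \<partial>lborel)"
    unfolding lborel_prod by (rule nn_integral_cmult) (use Q_meas in measurable)
  \<comment> \<open>The product measure is Lebesgue measure on a space of dimension 2d; the inserted
    factor is the Jacobian of its dilation by s.\<close>
  also have "\<dots> = ennreal (?C / s ^ (2 * DIM('a))) * (ennreal (s ^ (2 * DIM('a))) * (\<integral>\<^sup>+z. Q H (0 + s *\<^sub>R z) \<partial>lborel))"
    using assms(3) by (simp add: mult.assoc[symmetric] flip: ennreal_mult')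
  also have "ennreal (s ^ (2 * DIM('a))) * (\<integral>\<^sup>+z. Q H (0 + s *\<^sub>R z) \<partial>lborel) = slobodeckii_energy \<sigma> p g"
    using nn_integral_lborel_affine[OF Q_meas, of s 0] assms(3)
    unfolding energy lborel_prod by (simp add: mult_2)
  also have "?C / s ^ (2 * DIM('a)) = \<bar>c\<bar> powr p * s powr (\<sigma> * p - real DIM('a))"
  proof -
    have "\<sigma> = real k + frac \<sigma>" using assms(1) by (simp add: k_def frac_def)
    then have "\<sigma> * p - real DIM('a) = real k * p + b - real (2 * DIM('a))"
      unfolding b_def by (metis (no_types, opaque_lifting) add_diff_cancel_right distrib_right
          group_cancel.add1 mult_2 of_nat_add)
    moreover have "\<bar>c * s ^ k\<bar> powr p = \<bar>c\<bar> powr p * s powr (real k * p)"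
      using assms(3) by (simp add: abs_mult powr_mult powr_powr flip: powr_realpow)
    ultimately show ?thesis
      using assms(3) by (simp only: powr_add powr_diff powr_realpow times_divide_eq_right mult.assoc)
  qed
  finally show ?thesis .
qed

section \<open>Barenblatt solutions\<close>

lemma nn_integral_powr_eq_top:
  assumes "\<rho> \<le> -1" "T > 0"
  shows "(\<integral>\<^sup>+t. ennreal (t powr \<rho>) * indicator {0<..<T} t \<partial>lborel) = \<infinity>"
proof (rule ccontr)
  let ?I = "\<integral>\<^sup>+t. ennreal (t powr \<rho>) * indicator {0<..<T} t \<partial>lborel"
  assume "?I \<noteq> \<infinity>"
  then obtain r where r: "?I = ennreal r" "r \<ge> 0" by (cases ?I) auto
  \<comment> \<open>\<tau> stays below T and at most 1, where t powr \<rho> dominates 1/t. The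
    choice of \<epsilon> makes the integral of 1/t from \<epsilon> to \<tau> equal to r + 1, more
    than the supposed value r.\<close>
  define \<tau> where "\<tau> = min (T / 2) 1"
  define \<epsilon> where "\<epsilon> = \<tau> * exp (- (r + 1))"
  have \<tau>: "0 < \<tau>" "\<tau> < T" "\<tau> \<le> 1" using assms(2) by (auto simp: \<tau>_def)
  have \<epsilon>: "0 < \<epsilon>" "\<epsilon> \<le> \<tau>" using \<tau> r by (auto simp: \<epsilon>_def)
  have "ennreal (ln \<tau> - ln \<epsilon>) = (\<integral>\<^sup>+t. ennreal (1 / t) * indicator {\<epsilon>..\<tau>} t \<partial>lborel)"
    using \<epsilon> by (intro nn_integral_FTC_Icc[symmetric]) (auto intro!: derivative_eq_intros)
  also have "\<dots> \<le> ?I"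
  proof (rule nn_integral_mono)
    fix t :: real
    have "1 / t \<le> t powr \<rho>" if "\<epsilon> \<le> t" "t \<le> \<tau>"
      using powr_mono'[OF assms(1), of t] that \<tau> \<epsilon> by (simp add: powr_minus_divide)
    then show "ennreal (1 / t) * indicator {\<epsilon>..\<tau>} t \<le> ennreal (t powr \<rho>) * indicator {0<..<T} t"
      using \<tau> \<epsilon> by (auto simp: indicator_def intro!: ennreal_leI)
  qed
  finally have "ln \<tau> - ln \<epsilon> \<le> r" using r by simp
  then show False using \<tau> by (simp add: \<epsilon>_def ln_mult)
qed

section \<open>Signed powers, integrability and continuity\<close>

lemma signed_power_mult: "signed_power \<mu> (v * w) = signed_power \<mu> v * signed_power \<mu> w"
  by (simp add: signed_power_def abs_mult powr_mult)

lemma signed_power_powr: "t > 0 \<Longrightarrow> signed_power \<mu> (t powr a) = t powr (a * \<mu>)"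
  by (simp add: signed_power_def powr_powr algebra_simps flip: powr_add)

lemma signed_power_eq_0_iff: "signed_power \<mu> w = 0 \<longleftrightarrow> w = 0"
  by (simp add: signed_power_def)

text \<open>As \<mu> - 1 is nonnegative and u is bounded, the power is dominated by a constant
  multiple of u.\<close>

lemma integrable_signed_power:
  assumes u: "integrable M u" and K: "\<And>x. \<bar>u x\<bar> \<le> K" and "1 \<le> \<mu>"
  shows "integrable M (\<lambda>x. signed_power \<mu> (u x))"
proof (rule Bochner_Integration.integrable_bound)
  show "integrable M (\<lambda>x. K powr (\<mu> - 1) * u x)" using u by simp
  show "(\<lambda>x. signed_power \<mu> (u x)) \<in> borel_measurable M"
    unfolding signed_power_def using borel_measurable_integrable[OF u] by measurable
  have "\<bar>u x\<bar> powr (\<mu> - 1) \<le> K powr (\<mu> - 1)" for x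
    using K assms(3) by (intro powr_mono2) auto
  then show "AE x in M. norm (signed_power \<mu> (u x)) \<le> norm (K powr (\<mu> - 1) * u x)"
    by (auto simp: signed_power_def abs_mult intro!: mult_right_mono)
qed

text \<open>The set where a continuous function is nonzero is open, and a nonempty open set is not a
  null set.\<close>

lemma not_AE_eq_0_if_continuous:
  fixes v :: "'a::euclidean_space \<Rightarrow> real"
  assumes "continuous_on UNIV v" "v x \<noteq> 0"
  shows "\<not> (AE x in lborel. v x = 0)"
proof
  assume "AE x in lborel. v x = 0"
  then obtain N where "{x. v x \<noteq> 0} \<subseteq> N" "N \<in> null_sets lborel"
    by (auto elim!: AE_E simp: null_sets_def)
  then have "negligible {x. v x \<noteq> 0}"
    using negligible_iff_null_sets negligible_subset null_sets_completionI by blast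
  moreover have "open {x. v x \<noteq> 0}"
    using assms(1) by (intro open_Collect_neq continuous_on_const)
  ultimately show False using assms(2) open_not_negligible by blast
qed

lemma hoelder_imp_continuous_on:
  fixes f :: "real \<Rightarrow> real"
  assumes "\<gamma> > 0" and "\<And>r s. r \<in> S \<Longrightarrow> s \<in> S \<Longrightarrow> \<bar>f r - f s\<bar> \<le> C * \<bar>r - s\<bar> powr \<gamma>"
  shows "continuous_on S f"
  unfolding continuous_on_def
proof
  fix r assume r: "r \<in> S"
  have "((\<lambda>s. C * \<bar>s - r\<bar> powr \<gamma>) \<longlongrightarrow> C * \<bar>r - r\<bar> powr \<gamma>) (at r within S)"
    using assms(1) by (intro tendsto_intros tendsto_powr' always_eventually) auto
  then have "((\<lambda>s. C * \<bar>s - r\<bar> powr \<gamma>) \<longlongrightarrow> 0) (at r within S)" by simp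
  then have "((\<lambda>s. f s - f r) \<longlongrightarrow> 0) (at r within S)"
    by (rule Lim_null_comparison[rotated]) (use assms(2) r in \<open>auto simp: eventually_at_filter\<close>)
  then show "(f \<longlongrightarrow> f r) (at r within S)" by (rule LIM_zero_cancel)
qed

lemma hom_sobolev_norm_powr:
  assumes "p > 0"
  shows "hom_sobolev_norm \<sigma> p g powr p = enn2real (slobodeckii_energy \<sigma> p g)"
  using assms by (simp add: hom_sobolev_norm_def powr_powr)

theorem proposition3p3:
  fixes T m a \<mu> \<sigma> :: real
    and u :: "real \<Rightarrow> 'a::euclidean_space \<Rightarrow> real"
  assumes "T > 0" and "m > 1" and "0 < a" and "a < 2"
    and "barenblatt_solution m a u"
    and "1 \<le> \<mu>" and "\<mu> \<le> m"
    and "\<sigma> > 0" and "\<sigma> \<notin> \<int>"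
    and "in_Lq_hom_sobolev T (m / \<mu>) \<sigma> (m / \<mu>) (\<lambda>t x. signed_power \<mu> (u t x))"
  shows "\<sigma> < a * \<mu> / m"
proof -
  define p where "p = m / \<mu>"
  define d where "d = real DIM('a)"
  define \<alpha> where "\<alpha> = d / (d * (m - 1) + a)"
  define \<beta> where "\<beta> = \<alpha> / d"
  define g where "g = (\<lambda>t x. signed_power \<mu> (u t x))"
  have "p > 0" "\<mu> * p = m" "d > 0"
    using assms(2,6) by (auto simp: p_def d_def)
  have "d * (m - 1) + a > 0" using \<open>d > 0\<close> assms(2,3) by (intro add_pos_pos mult_pos_pos) auto
  obtain f \<gamma> C r where f: "bounded (f ` {0..})" "integrable lborel (\<lambda>x::'a. f (norm x))"
    and hoelder: "\<gamma> > 0" "\<forall>r\<ge>0. \<forall>s\<ge>0. \<bar>f r - f s\<bar> \<le> C * \<bar>r - s\<bar> powr \<gamma>"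
    and r: "r \<ge> 0" "f r \<noteq> 0"
    and u': "\<forall>t>0. \<forall>x. u t x = t powr (- \<alpha>) * f (norm x * t powr (- \<beta>))"
    using assms(5) unfolding barenblatt_solution_def Let_def \<alpha>_def[symmetric] \<beta>_def[symmetric] d_def[symmetric]
    by (elim conjE exE) (rule that)
  have u: "u t x = t powr (- \<alpha>) * f (norm x * t powr (- \<beta>))" if "t > 0" for t x
    using u' that by simp
  \<comment> \<open>The exponents in time and space are both m / \<mu>, so the quantity integrated
    in time is the energy itself, without a further power.\<close>
  have W: "AE t in restrict_space lborel {0<..<T}. in_hom_sobolev \<sigma> p (g t)"
    and fin: "(\<integral>\<^sup>+t. ennreal (hom_sobolev_norm \<sigma> p (g t) powr p) \<partial>restrict_space lborel {0<..<T}) < \<infinity>"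
    using assms(10) by (simp_all add: in_Lq_hom_sobolev_def Let_def p_def g_def)
  have "\<exists>t0. 0 < t0 \<and> t0 < T \<and> in_hom_sobolev \<sigma> p (g t0)"
  proof (rule ccontr)
    assume none: "\<not> ?thesis"
    have "AE t in lborel. t \<in> {0<..<T} \<longrightarrow> in_hom_sobolev \<sigma> p (g t)"
      using W by (subst (asm) AE_restrict_space_iff) auto
    then have "AE t in lborel. t \<notin> {0<..<T}"
      by (rule AE_mp) (use none in auto)
    then have "emeasure lborel {0<..<T} = 0"
      by (subst (asm) AE_iff_measurable[of "{0<..<T}"]) auto
    then show False using assms(1) by simp
  qed
  then obtain t0 where t0: "t0 > 0" and W0: "in_hom_sobolev \<sigma> p (g t0)" by blast

  define s0 where "s0 = t0 powr (- \<beta>)"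
  have "s0 > 0" using t0 by (simp add: s0_def)
  have u0: "u t0 = (\<lambda>x. t0 powr (- \<alpha>) * f (norm (0 + s0 *\<^sub>R x)))"
    using u[OF t0] \<open>s0 > 0\<close> by (simp add: fun_eq_iff s0_def mult.commute)
  have "integrable lborel (u t0)"
    unfolding u0 using \<open>s0 > 0\<close>
    by (intro integrable_mult_right lborel_integrable_affine[OF f(2)]) auto
  moreover obtain K where "\<And>r. r \<ge> 0 \<Longrightarrow> \<bar>f r\<bar> \<le> K"
    using f(1) by (auto simp: bounded_iff)
  then have "\<bar>u t0 x\<bar> \<le> t0 powr (- \<alpha>) * K" for x
    unfolding u0 by (auto simp: abs_mult intro!: mult_left_mono)
  ultimately have int: "integrable lborel (g t0)"
    unfolding g_def using assms(6) by (rule integrable_signed_power)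
  have "continuous_on {0..} f"
    using hoelder by (intro hoelder_imp_continuous_on) auto
  then have "continuous_on UNIV (u t0)"
    unfolding u0 by (intro continuous_on_mult_left continuous_on_compose2[of "{0..}" f UNIV "\<lambda>x. norm (0 + s0 *\<^sub>R x)"])
      (simp_all add: continuous_intros image_subset_iff)
  \<comment> \<open>At (r / s0) e the profile is evaluated exactly at the radius r where it is
    nonzero.\<close>
  moreover obtain e :: 'a where "e \<in> Basis" using nonempty_Basis by blast
  then have "u t0 ((r / s0) *\<^sub>R e) \<noteq> 0"
    unfolding u0 using r t0 \<open>s0 > 0\<close> by simp
  ultimately have "\<not> (AE x in lborel. g t0 x = 0)"
    unfolding g_def signed_power_eq_0_iff by (rule not_AE_eq_0_if_continuous)
  with int W0 have "slobodeckii_energy \<sigma> p (g t0) > 0" by (intro slobodeckii_energy_pos)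
  moreover have "slobodeckii_energy \<sigma> p (g t0) < \<infinity>" using W0 by (simp add: in_hom_sobolev_def)
  ultimately obtain E where E: "slobodeckii_energy \<sigma> p (g t0) = ennreal E" "E > 0"
    by (cases "slobodeckii_energy \<sigma> p (g t0)") auto

  \<comment> \<open>The amplitude (t / t0) powr (- \<alpha> \<mu>), raised to the power p,
    contributes \<alpha> m because \<mu> p = m. The dilation by (t / t0) powr (- \<beta>)
    contributes the other summand.\<close>
  define \<rho> where "\<rho> = - (\<alpha> * m + \<beta> * (\<sigma> * p - d))"
  have energy: "hom_sobolev_norm \<sigma> p (g t) powr p = (E * t0 powr (- \<rho>)) * t powr \<rho>" if t: "t > 0" for t
  proof -
    have "g t = (\<lambda>x. (t / t0) powr (- (\<alpha> * \<mu>)) * g t0 ((t / t0) powr (- \<beta>) *\<^sub>R x))"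
    proof
      fix x
      have *: "u t x = (t / t0) powr (- \<alpha>) * u t0 ((t / t0) powr (- \<beta>) *\<^sub>R x)"
        using t t0 by (simp add: u powr_divide mult_ac)
      show "g t x = (t / t0) powr (- (\<alpha> * \<mu>)) * g t0 ((t / t0) powr (- \<beta>) *\<^sub>R x)"
        unfolding g_def * using t t0 by (simp add: signed_power_mult signed_power_powr)
    qed
    then have "slobodeckii_energy \<sigma> p (g t) = ennreal (\<bar>(t / t0) powr (- (\<alpha> * \<mu>))\<bar> powr p *
        ((t / t0) powr (- \<beta>)) powr (\<sigma> * p - d)) * ennreal E"
      using slobodeckii_energy_scale[of \<sigma> p "(t / t0) powr (- \<beta>)" "g t0"] W0 assms(8) \<open>p > 0\<close> t t0 E
      by (simp add: in_hom_sobolev_def d_def)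
    also have "\<bar>(t / t0) powr (- (\<alpha> * \<mu>))\<bar> powr p * ((t / t0) powr (- \<beta>)) powr (\<sigma> * p - d) = (t / t0) powr \<rho>"
      using \<open>\<mu> * p = m\<close> by (simp add: powr_powr \<rho>_def mult.assoc flip: powr_add)
    finally show ?thesis
      using t t0 E \<open>p > 0\<close>
      by (simp add: hom_sobolev_norm_powr powr_divide powr_minus field_simps flip: ennreal_mult')
  qed
  have "(\<integral>\<^sup>+t. ennreal (hom_sobolev_norm \<sigma> p (g t) powr p) \<partial>restrict_space lborel {0<..<T}) =
      (\<integral>\<^sup>+t. ennreal (E * t0 powr (- \<rho>)) * (ennreal (t powr \<rho>) * indicator {0<..<T} t) \<partial>lborel)"
    using E by (subst nn_integral_restrict_space)
      (auto intro!: nn_integral_cong simp: energy indicator_def ennreal_mult')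
  also have "\<dots> = ennreal (E * t0 powr (- \<rho>)) * (\<integral>\<^sup>+t. ennreal (t powr \<rho>) * indicator {0<..<T} t \<partial>lborel)"
    by (rule nn_integral_cmult) measurable
  finally have "(\<integral>\<^sup>+t. ennreal (t powr \<rho>) * indicator {0<..<T} t \<partial>lborel) \<noteq> \<infinity>"
    using fin E t0 by (auto simp: ennreal_mult_eq_top_iff)
  then have "\<rho> > -1" using nn_integral_powr_eq_top[of \<rho> T] assms(1) by (cases "\<rho> \<le> -1") auto
  \<comment> \<open>As \<alpha> = d \<beta>, both terms have the denominator d (m - 1) + a. In the
    comparison with 1 the part d (m - 1) cancels, which leaves \<sigma> p < a.\<close>
  moreover have "\<alpha> * m + \<beta> * (\<sigma> * p - d) = (d * m + \<sigma> * p - d) / (d * (m - 1) + a)"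
    using \<open>d > 0\<close> by (simp add: \<alpha>_def \<beta>_def diff_divide_distrib add_divide_distrib)
  ultimately have "(d * m + \<sigma> * p - d) / (d * (m - 1) + a) < 1" by (simp add: \<rho>_def)
  then have "\<sigma> * p < a"
    using \<open>d * (m - 1) + a > 0\<close> by (simp add: divide_less_eq algebra_simps)
  then show ?thesis using assms(2,6) by (simp add: p_def field_simps)
qed

end
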